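(* Let $\Theta$ be a non-empty finite parameter space, let $\mathcal I$ be the set of all (coded, finite, effective) inference bases with parameter space $\Theta$, and let $L,S,C\subseteq\mathcal I\times\mathcal I$ be the likelihood, sufficiency and conditionality relations. Writing $\overline D$ for the smallest equivalence relation on $\mathcal I$ containing $D$, one has $$\overline C=L\qquad\text{and}\qquad\overline{C\cup S}=L.$$ Moreover, any $L$-related pair is joined by a chain of four $C$-steps: if $(I,I')\in L$, there are $J_1,J_2,J_3\in\mathcal I$ with $(I,J_1),(J_1,J_2),(J_2,J_3),(J_3,I')\in C$.
   Context: **Models and inference bases.** Fix a non-empty finite set $\Theta$ and work in a fixed set-theoretic universe. A statistical model $E$ consists of a finite non-empty sample space $\mathcal X_E$, a family of probability mass functions $f_{E,\theta}$ on $\mathcal X_E$ ($\theta\in\Theta$), and an injective outcome code $c_E:\mathcal X_E\to\mathbb N$, such that every outcome is effective: for each $x\in\mathcal X_E$ there is $\theta\in\Theta$ with $f_{E,\theta}(x)>0$. Write $\mathbb P_{E,\theta}$ for the probability with mass function $f_{E,\theta}$. An inference base is a pair $I=(E,x)$ with $x\in\mathcal X_E$; $\mathcal I$ is the set of all inference bases with parameter space $\Theta$. Below $I_i=(E_i,x_i)$. **Likelihood relation.** $(I_1,I_2)\in L$ iff there is $k>0$ with $f_{E_1,\theta}(x_1)=k f_{E_2,\theta}(x_2)$ for all $\theta\in\Theta$. **Sufficiency relation.** For a surjection $T:\mathcal X_E\to\mathcal X_{E_T}$ (a statistic), the induced model $E_T$ has mass functions $f_{E_T,\theta}(t)=\sum_{x:T(x)=t}f_{E,\theta}(x)$.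 $T$ is sufficient if the conditional distribution given $T$ is free of $\theta$, i.e. there is a function $g$ on $\mathcal X_E$ with $f_{E,\theta}(x)=g(x)f_{E_T,\theta}(T(x))$ for all $x,\theta$; it is minimal sufficient if it is sufficient and is a function of every sufficient statistic. $(I_1,I_2)\in S$ iff there are minimal sufficient statistics $T_i:\mathcal X_{E_i}\to\mathcal X_{E_{T_i}}$ (surjective), $i=1,2$, and a bijection $h:\mathcal X_{E_{T_2}}\to\mathcal X_{E_{T_1}}$ with $f_{E_{T_1},\theta}(h(t))=f_{E_{T_2},\theta}(t)$ for all $\theta\in\Theta$, $t\in\mathcal X_{E_{T_2}}$, and $T_1(x_1)=h(T_2(x_2))$. **Conditionality relation.** A statistic $A:\mathcal X_E\to\mathcal A_0$ is ancillary for $E$ if its distribution under $\mathbb P_{E,\theta}$ does not depend on $\theta$. Say $I_1\to I_2$ if there are an ancillary statistic $A:\mathcal X_{E_1}\to\mathcal A_0$ for $E_1$ with, for $a=A(x_1)$, $\mathbb P_{E_1,\theta}(A=a)>0$ for every $\theta$, and an injection $\iota:\mathcal X_{E_2}\to\mathcal X_{E_1}$ with image exactly $A^{-1}\{a\}$, $\iota(x_2)=x_1$, and $f_{E_2,\theta}(y)=f_{E_1,\theta}(\iota(y))/\mathbb P_{E_1,\theta}(A=a)$ for all $\theta\in\Theta$, $y\in\mathcal X_{E_2}$, such that at least one of the following holds: (ordinary branch) $c_{E_1}(\iota(y))=c_{E_2}(y)$ for every $y\in\mathcal X_{E_2}$; (mixed-experiment branch) $A$ is surjective onto $\mathcal A_0$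 and $\mathcal A_0$ has at least two elements (no condition on codes). Then $(I_1,I_2)\in C$ iff $I_1\to I_2$ or $I_2\to I_1$. *)

theory Defs
  imports
    "HOL-Probability.Probability_Mass_Function"
    "HOL-Library.Infinite_Typeclass"
begin

(* The type 'u is the universe of possible outcomes and of values of statistics, and the
   type 'p is the parameter space.  Sample spaces and codomains of statistics are sets over 'u. *)

record ('u, 'p) model =
  outcomes :: "'u set"
  mass :: "'p \<Rightarrow> 'u pmf"
  outcome_code :: "'u \<Rightarrow> nat"

(* A model must be determined by its data on the sample space.  The support condition makes
   each mass function a probability mass function on the sample space (extended by zero to 'u),
   and extensionality fixes the irrelevant values of the code. *)
definition statistical_model :: "('u, 'p) model \<Rightarrow> bool" where
  "statistical_model E \<longleftrightarrow>
     finite (outcomes E) \<and> outcomes E \<noteq> {} \<and>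
     (\<forall>\<theta>. set_pmf (mass E \<theta>) \<subseteq> outcomes E) \<and>
     inj_on (outcome_code E) (outcomes E) \<and>
     outcome_code E \<in> extensional (outcomes E) \<and>
     (\<forall>x\<in>outcomes E. \<exists>\<theta>. pmf (mass E \<theta>) x > 0)"

type_synonym ('u, 'p) inference_base = "('u, 'p) model \<times> 'u"

definition inference_bases :: "('u, 'p) inference_base set" where
  "inference_bases = {(E, x). statistical_model E \<and> x \<in> outcomes E}"

definition likelihood_rel :: "('u, 'p) inference_base rel" where
  "likelihood_rel = {((E1, x1), (E2, x2)).
     (E1, x1) \<in> inference_bases \<and> (E2, x2) \<in> inference_bases \<and>
     (\<exists>k::real. k > 0 \<and> (\<forall>\<theta>. pmf (mass E1 \<theta>) x1 = k * pmf (mass E2 \<theta>) x2))}"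

(* A statistic T is a surjection onto its codomain, which is therefore T ` outcomes E. *)
definition induced_mass :: "('u, 'p) model \<Rightarrow> ('u \<Rightarrow> 'u) \<Rightarrow> 'p \<Rightarrow> 'u \<Rightarrow> real" where
  "induced_mass E T \<theta> t = (\<Sum>x | x \<in> outcomes E \<and> T x = t. pmf (mass E \<theta>) x)"

definition sufficient :: "('u, 'p) model \<Rightarrow> ('u \<Rightarrow> 'u) \<Rightarrow> bool" where
  "sufficient E T \<longleftrightarrow>
     (\<exists>g :: 'u \<Rightarrow> real. \<forall>x\<in>outcomes E. \<forall>\<theta>.
        pmf (mass E \<theta>) x = g x * induced_mass E T \<theta> (T x))"

definition minimal_sufficient :: "('u, 'p) model \<Rightarrow> ('u \<Rightarrow> 'u) \<Rightarrow> bool" where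
  "minimal_sufficient E T \<longleftrightarrow>
     sufficient E T \<and>
     (\<forall>U. sufficient E U \<longrightarrow> (\<exists>\<phi>. \<forall>x\<in>outcomes E. T x = \<phi> (U x)))"

definition sufficiency_rel :: "('u, 'p) inference_base rel" where
  "sufficiency_rel = {((E1, x1), (E2, x2)).
     (E1, x1) \<in> inference_bases \<and> (E2, x2) \<in> inference_bases \<and>
     (\<exists>T1 T2 h. minimal_sufficient E1 T1 \<and> minimal_sufficient E2 T2 \<and>
        bij_betw h (T2 ` outcomes E2) (T1 ` outcomes E1) \<and>
        (\<forall>\<theta>. \<forall>t\<in>T2 ` outcomes E2. induced_mass E1 T1 \<theta> (h t) = induced_mass E2 T2 \<theta> t) \<and>
        T1 x1 = h (T2 x2))}"

definition ancillary :: "('u, 'p) model \<Rightarrow> ('u \<Rightarrow> 'u) \<Rightarrow> 'u set \<Rightarrow> bool" where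
  "ancillary E A A0 \<longleftrightarrow>
     A \<in> outcomes E \<rightarrow> A0 \<and>
     (\<forall>\<theta> \<theta>'. map_pmf A (mass E \<theta>) = map_pmf A (mass E \<theta>'))"

definition event_prob :: "('u, 'p) model \<Rightarrow> ('u \<Rightarrow> 'u) \<Rightarrow> 'u \<Rightarrow> 'p \<Rightarrow> real" where
  "event_prob E A a \<theta> = measure_pmf.prob (mass E \<theta>) {x \<in> outcomes E. A x = a}"

(* The first disjunct at the end is the ordinary branch, the second one the
   mixed-experiment branch. *)
definition conditional_step :: "('u, 'p) inference_base rel" where
  "conditional_step = {((E1, x1), (E2, x2)).
     (E1, x1) \<in> inference_bases \<and> (E2, x2) \<in> inference_bases \<and>
     (\<exists>A A0 \<iota>. ancillary E1 A A0 \<and>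
        (\<forall>\<theta>. event_prob E1 A (A x1) \<theta> > 0) \<and>
        inj_on \<iota> (outcomes E2) \<and>
        \<iota> ` outcomes E2 = {x \<in> outcomes E1. A x = A x1} \<and>
        \<iota> x2 = x1 \<and>
        (\<forall>\<theta>. \<forall>y\<in>outcomes E2.
           pmf (mass E2 \<theta>) y = pmf (mass E1 \<theta>) (\<iota> y) / event_prob E1 A (A x1) \<theta>) \<and>
        ((\<forall>y\<in>outcomes E2. outcome_code E1 (\<iota> y) = outcome_code E2 y) \<or>
         (A ` outcomes E1 = A0 \<and> (\<exists>a\<in>A0. \<exists>b\<in>A0. a \<noteq> b))))}"

definition conditionality_rel :: "('u, 'p) inference_base rel" where
  "conditionality_rel = conditional_step \<union> conditional_step\<inverse>"

definition equiv_closure :: "'a set \<Rightarrow> 'a rel \<Rightarrow> 'a rel" where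
  "equiv_closure I D = \<Inter>{R. equiv I R \<and> D \<subseteq> R}"

end

theory Submission
  imports Defs
begin

text \<open>
  Both \<^term>\<open>conditionality_rel\<close> and \<^term>\<open>sufficiency_rel\<close> lie in the likelihood relation, which is
  an equivalence: conditioning on an ancillary event divides the likelihood by a probability that
  is free of the parameter (\<open>conditionality_rel_subset\<close>), and a sufficient statistic reduces it up to
  the parameter-free factor \<open>g\<close> (\<open>sufficiency_rel_subset\<close>).  So the closures are contained in it,
  and everything rests on the four-step chain.

  For the chain, every base \<open>(E, x)\<close> with likelihood \<open>f \<theta>\<close> is linked to a two-point experiment
  that shows an outcome of probability \<open>s * f \<theta>\<close>, where \<open>0 < s < 1\<close> is arbitrary.  The link is
  one larger experiment with two different ancillaries.  Mix \<open>E\<close>, with weight \<open>s / (1 + s)\<close>, with a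
  coin, with weight \<open>1 / (1 + s)\<close>, whose sides \<open>v\<close> and \<open>u\<close> have probabilities \<open>s * f \<theta>\<close> and
  \<open>1 - s * f \<theta>\<close>.  The component that was performed is ancillary and conditioning on it gives back
  \<open>E\<close>.  But also the event \<open>{x, u}\<close> has the constant probability
  \<open>(s * f \<theta> + (1 - s * f \<theta>)) / (1 + s) = 1 / (1 + s)\<close>, and conditioning on it gives the
  two-point experiment (\<open>conditional_bridge\<close>).

  If \<open>f1 = k * f2\<close> then the two-point experiments for \<open>(E1, x1)\<close> with factor \<open>s\<close> and for
  \<open>(E2, x2)\<close> with factor \<open>s * k\<close> are the same, and the two bridges meet there.  All four steps
  are in the mixed-experiment branch, so that codes never have to match.
\<close>

section \<open>The likelihood relation is an equivalence containing the other two\<close>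

lemma equiv_likelihood_rel:
  "equiv inference_bases (likelihood_rel :: ('u, 'p) inference_base rel)" (is "equiv ?B ?L")
proof (rule equivI)
  show "?L \<subseteq> ?B \<times> ?B"
    by (auto simp: likelihood_rel_def)
  show "refl_on ?B ?L"
    by (auto simp: refl_on_def likelihood_rel_def intro: exI[of _ 1])
  show "sym ?L"
  proof (rule symI)
    fix I1 I2 :: "('u, 'p) inference_base"
    assume "(I1, I2) \<in> ?L"
    then obtain E1 x1 E2 x2 k where I: "I1 = (E1, x1)" "I2 = (E2, x2)"
      and base: "I1 \<in> ?B" "I2 \<in> ?B"
      and k: "k > 0" "\<And>\<theta>. pmf (mass E1 \<theta>) x1 = k * pmf (mass E2 \<theta>) x2"
      by (auto simp: likelihood_rel_def)
    then have "1 / k > 0 \<and> (\<forall>\<theta>. pmf (mass E2 \<theta>) x2 = 1 / k * pmf (mass E1 \<theta>) x1)"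
      by simp
    with base show "(I2, I1) \<in> ?L"
      unfolding I likelihood_rel_def by blast
  qed
  show "trans ?L"
  proof (rule transI)
    fix I1 I2 I3 :: "('u, 'p) inference_base"
    assume rel: "(I1, I2) \<in> ?L" "(I2, I3) \<in> ?L"
    from rel(1) obtain E1 x1 E2 x2 k where I: "I1 = (E1, x1)" and I2: "I2 = (E2, x2)"
      and k: "k > 0" "\<And>\<theta>. pmf (mass E1 \<theta>) x1 = k * pmf (mass E2 \<theta>) x2"
      by (auto simp: likelihood_rel_def)
    from rel(2) obtain E3 x3 l where I3: "I3 = (E3, x3)"
      and l: "l > 0" "\<And>\<theta>. pmf (mass E2 \<theta>) x2 = l * pmf (mass E3 \<theta>) x3"
      by (auto simp: likelihood_rel_def I2)
    have base: "I1 \<in> ?B" "I3 \<in> ?B"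
      using rel by (auto simp: likelihood_rel_def)
    have "k * l > 0 \<and> (\<forall>\<theta>. pmf (mass E1 \<theta>) x1 = k * l * pmf (mass E3 \<theta>) x3)"
      using k l by simp
    with base show "(I1, I3) \<in> ?L"
      unfolding I I3 likelihood_rel_def by blast
  qed
qed

lemma event_prob_eq_pmf_map:
  assumes "statistical_model E"
  shows "event_prob E A a \<theta> = pmf (map_pmf A (mass E \<theta>)) a"
proof -
  have "set_pmf (mass E \<theta>) \<subseteq> outcomes E"
    using assms by (auto simp: statistical_model_def)
  then show ?thesis
    unfolding event_prob_def pmf_map
    by (intro measure_pmf.finite_measure_eq_AE) (auto simp: AE_measure_pmf_iff)
qed

lemma conditional_step_subset: "conditional_step \<subseteq> likelihood_rel"
proof (clarsimp simp: conditional_step_def likelihood_rel_def)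
  fix E1 E2 :: "('a, 'b) model" and x2 A A0 \<iota>
  assume base: "(E1, \<iota> x2) \<in> inference_bases" "(E2, x2) \<in> inference_bases"
    and anc: "ancillary E1 A A0"
    and pos: "\<forall>\<theta>. 0 < event_prob E1 A (A (\<iota> x2)) \<theta>"
    and cond: "\<forall>\<theta>. \<forall>y\<in>outcomes E2. pmf (mass E2 \<theta>) y =
                 pmf (mass E1 \<theta>) (\<iota> y) / event_prob E1 A (A (\<iota> x2)) \<theta>"
  define c where "c = event_prob E1 A (A (\<iota> x2)) undefined"
  have "event_prob E1 A (A (\<iota> x2)) \<theta> = c" for \<theta>
    using base anc unfolding c_def
    by (simp add: inference_bases_def event_prob_eq_pmf_map ancillary_def) metis
  moreover have "c > 0"
    using pos by (simp add: c_def)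
  moreover have "x2 \<in> outcomes E2"
    using base by (simp add: inference_bases_def)
  ultimately show "\<exists>k>0. \<forall>\<theta>. pmf (mass E1 \<theta>) (\<iota> x2) = k * pmf (mass E2 \<theta>) x2"
    using cond by (intro exI[of _ c]) auto
qed

lemma conditionality_rel_subset: "conditionality_rel \<subseteq> likelihood_rel"
  using conditional_step_subset equiv_likelihood_rel
  by (auto simp: conditionality_rel_def equiv_def dest: symD)

text \<open>
  The factor \<open>c\<close> is the value at \<open>x\<close> of the function \<open>g\<close> from sufficiency.  It is positive because
  \<open>x\<close> is effective: some parameter gives \<open>x\<close> positive probability.
\<close>

lemma sufficient_likelihood:
  assumes "sufficient E T" "(E, x) \<in> inference_bases"
  obtains c where "c > 0" "\<And>\<theta>. pmf (mass E \<theta>) x = c * induced_mass E T \<theta> (T x)"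
proof -
  from assms obtain g where g: "\<And>\<theta>. pmf (mass E \<theta>) x = g x * induced_mass E T \<theta> (T x)"
    by (auto simp: sufficient_def inference_bases_def)
  obtain \<theta> where "pmf (mass E \<theta>) x > 0"
    using assms(2) unfolding inference_bases_def statistical_model_def by blast
  moreover have "induced_mass E T \<theta> (T x) \<ge> 0"
    by (simp add: induced_mass_def sum_nonneg)
  ultimately have "g x > 0"
    by (metis g zero_less_mult_pos2 mult_zero_right less_eq_real_def less_irrefl)
  with g show ?thesis
    by (rule that[rotated])
qed

lemma sufficiency_rel_subset: "sufficiency_rel \<subseteq> likelihood_rel"
proof (clarsimp simp: sufficiency_rel_def likelihood_rel_def)
  fix E1 E2 :: "('a, 'b) model" and x1 x2 T1 T2 h
  assume base: "(E1, x1) \<in> inference_bases" "(E2, x2) \<in> inference_bases"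
    and suff: "minimal_sufficient E1 T1" "minimal_sufficient E2 T2"
    and iso: "\<forall>\<theta>. \<forall>t\<in>outcomes E2. induced_mass E1 T1 \<theta> (h (T2 t)) = induced_mass E2 T2 \<theta> (T2 t)"
    and eq: "T1 x1 = h (T2 x2)"
  obtain c1 where c1: "c1 > 0" "\<And>\<theta>. pmf (mass E1 \<theta>) x1 = c1 * induced_mass E1 T1 \<theta> (T1 x1)"
    using suff(1) base(1) sufficient_likelihood by (metis minimal_sufficient_def)
  obtain c2 where c2: "c2 > 0" "\<And>\<theta>. pmf (mass E2 \<theta>) x2 = c2 * induced_mass E2 T2 \<theta> (T2 x2)"
    using suff(2) base(2) sufficient_likelihood by (metis minimal_sufficient_def)
  have "x2 \<in> outcomes E2"
    using base by (simp add: inference_bases_def)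
  then show "\<exists>k>0. \<forall>\<theta>. pmf (mass E1 \<theta>) x1 = k * pmf (mass E2 \<theta>) x2"
    using c1 c2 iso eq by (intro exI[of _ "c1 / c2"]) auto
qed

section \<open>Conditioning on an event of constant probability\<close>

text \<open>
  The indicator of a proper non-empty event has two values, so it always qualifies for the
  mixed-experiment branch.
\<close>

lemma conditional_stepI:
  fixes E1 E2 :: "('u, 'p) model"
  assumes base: "(E1, x1) \<in> inference_bases" "(E2, x2) \<in> inference_bases"
    and D: "D \<subset> outcomes E1"
    and prob: "\<And>\<theta>. measure_pmf.prob (mass E1 \<theta>) D = c" "c > 0"
    and \<iota>: "bij_betw \<iota> (outcomes E2) D" "\<iota> x2 = x1"
    and cond: "\<And>\<theta> y. y \<in> outcomes E2 \<Longrightarrow> pmf (mass E2 \<theta>) y = pmf (mass E1 \<theta>) (\<iota> y) / c"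
  shows "((E1, x1), (E2, x2)) \<in> conditional_step"
proof -
  have "x2 \<in> outcomes E2"
    using base by (simp add: inference_bases_def)
  then have x1: "x1 \<in> D"
    using \<iota> by (auto simp: bij_betw_def)
  obtain w where w: "w \<in> outcomes E1" "w \<notin> D"
    using D by blast
  have neq: "x1 \<noteq> w"
    using x1 w by blast
  \<comment> \<open>The type of outcomes is also that of values of statistics, and \<open>x1\<close>, \<open>w\<close> are two distinct elements of it.\<close>
  define A where "A = (\<lambda>x. if x \<in> D then x1 else w)"
  have event: "{x \<in> outcomes E1. A x = A x1} = D"
    using D x1 neq by (auto simp: A_def)
  have "map_pmf A (mass E1 \<theta>) = map_pmf A (mass E1 \<theta>')" for \<theta> \<theta>'
  proof -
    have pmf_mem: "pmf (map_pmf (\<lambda>x. x \<in> D) (mass E1 \<theta>)) b = (if b then c else 1 - c)" for b \<theta>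
    proof -
      have "pmf (map_pmf (\<lambda>x. x \<in> D) (mass E1 \<theta>)) True = c"
        using prob(1) by (simp add: pmf_map vimage_def)
      then show ?thesis
        by (cases b) (simp_all add: pmf_False_conv_True)
    qed
    have "map_pmf (\<lambda>x. x \<in> D) (mass E1 \<theta>) = map_pmf (\<lambda>x. x \<in> D) (mass E1 \<theta>')"
      by (rule pmf_eqI) (simp only: pmf_mem)
    then have "map_pmf (\<lambda>b. if b then x1 else w) (map_pmf (\<lambda>x. x \<in> D) (mass E1 \<theta>)) =
               map_pmf (\<lambda>b. if b then x1 else w) (map_pmf (\<lambda>x. x \<in> D) (mass E1 \<theta>'))"
      by simp
    then show ?thesis
      by (simp add: map_pmf_comp A_def)
  qed
  then have "ancillary E1 A {x1, w}"
    unfolding ancillary_def by (auto simp: A_def)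
  moreover have "event_prob E1 A (A x1) \<theta> = c" for \<theta>
    unfolding event_prob_def event by (rule prob)
  moreover have "A ` outcomes E1 = {x1, w}"
    using x1 w D by (auto simp: A_def)
  ultimately show ?thesis
    unfolding conditional_step_def mem_Collect_eq prod.case
    using base \<iota> prob(2) cond neq
    by (intro conjI exI[of _ A] exI[of _ "{x1, w}"] exI[of _ \<iota>])
      (auto simp: event bij_betw_def)
qed

section \<open>Mixing with a coin\<close>

definition two_point_pmf :: "'u \<Rightarrow> 'u \<Rightarrow> real \<Rightarrow> 'u pmf" where
  "two_point_pmf a b q = map_pmf (\<lambda>z. if z then a else b) (bernoulli_pmf q)"

lemma set_two_point_pmf: "set_pmf (two_point_pmf a b q) \<subseteq> {a, b}"
  by (auto simp: two_point_pmf_def)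

lemma pmf_two_point_pmf:
  assumes "a \<noteq> b" "0 \<le> q" "q \<le> 1"
  shows "pmf (two_point_pmf a b q) y = (if y = a then q else if y = b then 1 - q else 0)"
proof -
  have "(\<lambda>z. if z then a else b) -` {y} = (if y = a then {True} else if y = b then {False} else {})"
    using assms by (auto split: if_splits)
  then show ?thesis
    using assms by (simp add: two_point_pmf_def pmf_map measure_pmf_single)
qed

definition some_code :: "'u set \<Rightarrow> 'u \<Rightarrow> nat" where
  "some_code X = restrict (SOME f. inj_on f X) X"

lemma some_code:
  assumes "finite X"
  shows "inj_on (some_code X) X" "some_code X \<in> extensional X"
proof -
  have "\<exists>f :: 'a \<Rightarrow> nat. inj_on f X"
    using finite_imp_inj_to_nat_seg[OF assms] by blast
  then have "inj_on (SOME f :: 'a \<Rightarrow> nat. inj_on f X) X"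
    by (rule someI_ex)
  then show "inj_on (some_code X) X"
    by (simp add: some_code_def)
  show "some_code X \<in> extensional X"
    by (simp add: some_code_def)
qed

definition two_point_model :: "'u \<Rightarrow> 'u \<Rightarrow> ('p \<Rightarrow> real) \<Rightarrow> ('u, 'p) model" where
  "two_point_model a b q =
     \<lparr>outcomes = {a, b}, mass = (\<lambda>\<theta>. two_point_pmf a b (q \<theta>)), outcome_code = some_code {a, b}\<rparr>"

lemma statistical_model_two_point:
  assumes "a \<noteq> b" "\<And>\<theta>. 0 \<le> q \<theta>" "\<And>\<theta>. q \<theta> < 1" "\<exists>\<theta>. q \<theta> > 0"
  shows "statistical_model (two_point_model a b q)"
  using assms set_two_point_pmf[of a b] some_code[of "{a, b}"]
  by (auto simp: statistical_model_def two_point_model_def pmf_two_point_pmf less_imp_le)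

definition coin_mixture :: "('u, 'p) model \<Rightarrow> 'u \<Rightarrow> 'u \<Rightarrow> real \<Rightarrow> ('p \<Rightarrow> real) \<Rightarrow> ('u, 'p) model" where
  "coin_mixture E u v p q =
     \<lparr>outcomes = {u, v} \<union> outcomes E,
      mass = (\<lambda>\<theta>. bernoulli_pmf p \<bind> (\<lambda>z. if z then mass E \<theta> else two_point_pmf v u (q \<theta>))),
      outcome_code = some_code ({u, v} \<union> outcomes E)\<rparr>"

lemma pmf_coin_mixture:
  assumes "u \<noteq> v" "0 \<le> q \<theta>" "q \<theta> \<le> 1" "0 \<le> p" "p \<le> 1"
  shows "pmf (mass (coin_mixture E u v p q) \<theta>) y =
    p * pmf (mass E \<theta>) y + (1 - p) * (if y = v then q \<theta> else if y = u then 1 - q \<theta> else 0)"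
  using assms by (auto simp: coin_mixture_def pmf_bind pmf_two_point_pmf)

lemma statistical_model_coin_mixture:
  assumes E: "statistical_model E" and uv: "u \<noteq> v" and p: "0 < p" "p < 1"
    and q: "\<And>\<theta>. 0 \<le> q \<theta>" "\<And>\<theta>. q \<theta> < 1" "\<exists>\<theta>. q \<theta> > 0"
  shows "statistical_model (coin_mixture E u v p q)"
proof -
  let ?M = "coin_mixture E u v p q"
  have outs: "outcomes ?M = {u, v} \<union> outcomes E"
    by (simp add: coin_mixture_def)
  have code: "outcome_code ?M = some_code ({u, v} \<union> outcomes E)"
    by (simp add: coin_mixture_def)
  have fin: "finite ({u, v} \<union> outcomes E)"
    using E by (simp add: statistical_model_def)
  have "set_pmf (mass ?M \<theta>) \<subseteq> outcomes ?M" for \<theta>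
    using E set_two_point_pmf[of v u "q \<theta>"]
    by (fastforce simp: coin_mixture_def statistical_model_def split: if_splits)
  moreover have "\<exists>\<theta>. pmf (mass ?M \<theta>) y > 0" if y: "y \<in> outcomes ?M" for y
  proof -
    have ge: "pmf (mass ?M \<theta>) y \<ge> p * pmf (mass E \<theta>) y"
      "pmf (mass ?M \<theta>) y \<ge> (1 - p) * (if y = v then q \<theta> else if y = u then 1 - q \<theta> else 0)" for \<theta>
      using uv p q by (auto simp: pmf_coin_mixture less_imp_le)
    from y consider "y = u" | "y = v" | "y \<in> outcomes E"
      by (auto simp: outs)
    then show ?thesis
    proof cases
      case 1
      then have "(1 - p) * (1 - q \<theta>) \<le> pmf (mass ?M \<theta>) y" for \<theta>
        using ge(2)[of \<theta>] uv by simp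
      moreover have "(1 - p) * (1 - q \<theta>) > 0" for \<theta>
        using p q(2)[of \<theta>] by simp
      ultimately show ?thesis
        by (meson less_le_trans)
    next
      case 2
      obtain \<theta> where "q \<theta> > 0"
        using q(3) by blast
      then have "(1 - p) * q \<theta> > 0"
        using p by simp
      then show ?thesis
        using ge(2)[of \<theta>] 2 by (auto intro: less_le_trans)
    next
      case 3
      then obtain \<theta> where "pmf (mass E \<theta>) y > 0"
        using E unfolding statistical_model_def by blast
      then have "p * pmf (mass E \<theta>) y > 0"
        using p by simp
      then show ?thesis
        using ge(1)[of \<theta>] by (auto intro: less_le_trans)
    qed
  qed
  ultimately show ?thesis
    using fin some_code[OF fin] code unfolding statistical_model_def by (simp add: outs)
qed

section \<open>The chain\<close>

text \<open>
  The common target of the two steps depends on \<open>(E, x)\<close> only through the scaled likelihood; this is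
  what lets the bridges of likelihood-equivalent bases end at the same base.  The weight
  \<open>p = s / (1 + s)\<close> is the solution of \<open>p = (1 - p) * s\<close>, which makes the likelihood cancel in the
  probability of \<open>{x, u}\<close>.
\<close>

lemma conditional_bridge:
  fixes E :: "('u::infinite, 'p) model"
  assumes base: "(E, x) \<in> inference_bases" and s: "0 < s" "s < 1" and ab: "a \<noteq> b"
  defines "q \<equiv> \<lambda>\<theta>. s * pmf (mass E \<theta>) x"
  obtains J where "(J, (E, x)) \<in> conditional_step"
    and "(J, (two_point_model a b q, a)) \<in> conditional_step"
proof -
  have E: "statistical_model E" and x: "x \<in> outcomes E"
    using base by (auto simp: inference_bases_def)
  then have fin: "finite (outcomes E)"
    by (simp add: statistical_model_def)
  obtain u where u: "u \<notin> outcomes E"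
    using ex_new_if_finite[OF infinite_UNIV fin] by blast
  obtain v where v: "v \<notin> insert u (outcomes E)"
    using ex_new_if_finite[OF infinite_UNIV, of "insert u (outcomes E)"] fin by blast
  have uv: "u \<noteq> v" "x \<noteq> u" "x \<noteq> v"
    using u v x by auto
  have q: "0 \<le> q \<theta>" "q \<theta> < 1" for \<theta>
  proof -
    show "0 \<le> q \<theta>"
      using s by (simp add: q_def)
    have "q \<theta> \<le> s * 1"
      unfolding q_def using s by (intro mult_left_mono pmf_le_1) auto
    then show "q \<theta> < 1"
      using s by simp
  qed
  have q_pos: "\<exists>\<theta>. q \<theta> > 0"
  proof -
    obtain \<theta> where "pmf (mass E \<theta>) x > 0"
      using E x unfolding statistical_model_def by blast
    then have "q \<theta> > 0"
      using s by (simp add: q_def)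
    then show ?thesis ..
  qed
  define p where "p = s / (1 + s)"
  have p: "0 < p" "p < 1" and p_eq: "p = (1 - p) * s"
    using s by (auto simp: p_def field_simps)
  define M where "M = coin_mixture E u v p q"
  have outs: "outcomes M = {u, v} \<union> outcomes E"
    by (simp add: M_def coin_mixture_def)
  have pmf_M: "pmf (mass M \<theta>) y =
      p * pmf (mass E \<theta>) y + (1 - p) * (if y = v then q \<theta> else if y = u then 1 - q \<theta> else 0)" for \<theta> y
    unfolding M_def using uv p q[of \<theta>] by (intro pmf_coin_mixture) auto
  have pmf_E_0: "pmf (mass E \<theta>) y = 0" if "y \<notin> outcomes E" for \<theta> y
    using E that by (auto simp: statistical_model_def pmf_eq_0_set_pmf)
  have baseM: "(M, x) \<in> inference_bases"
    using statistical_model_coin_mixture[OF E uv(1) p q q_pos] x outs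
    by (simp add: inference_bases_def M_def)
  have "((M, x), (E, x)) \<in> conditional_step"
  proof (rule conditional_stepI[where D = "outcomes E" and c = p and \<iota> = id])
    show "outcomes E \<subset> outcomes M"
      using u by (auto simp: outs)
    have pmf_ME: "pmf (mass M \<theta>) y = p * pmf (mass E \<theta>) y" if "y \<in> outcomes E" for \<theta> y
      using that u v by (auto simp: pmf_M)
    show "measure_pmf.prob (mass M \<theta>) (outcomes E) = p" for \<theta>
    proof -
      have "measure_pmf.prob (mass M \<theta>) (outcomes E) = p * (\<Sum>y\<in>outcomes E. pmf (mass E \<theta>) y)"
        using fin by (simp add: measure_measure_pmf_finite pmf_ME sum_distrib_left)
      then show ?thesis
        using E fin by (simp add: sum_pmf_eq_1 statistical_model_def)
    qed
    show "pmf (mass E \<theta>) y = pmf (mass M \<theta>) (id y) / p" if "y \<in> outcomes E" for \<theta> y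
      using that p by (simp add: pmf_ME)
  qed (use base baseM p in auto)
  moreover have "((M, x), (two_point_model a b q, a)) \<in> conditional_step"
  proof (rule conditional_stepI[where D = "{x, u}" and c = "1 - p" and \<iota> = "\<lambda>y. if y = a then x else u"])
    show "(two_point_model a b q, a) \<in> inference_bases"
      using statistical_model_two_point[OF ab q q_pos]
      by (simp add: inference_bases_def two_point_model_def)
    show "{x, u} \<subset> outcomes M"
      using uv x by (auto simp: outs)
    have "pmf (mass M \<theta>) x = p * pmf (mass E \<theta>) x" for \<theta>
      using uv by (simp add: pmf_M)
    also have "\<dots> \<theta> = (1 - p) * q \<theta>" for \<theta>
      using p_eq by (simp add: q_def)
    finally have pmf_x: "pmf (mass M \<theta>) x = (1 - p) * q \<theta>" for \<theta> .
    have pmf_u: "pmf (mass M \<theta>) u = (1 - p) * (1 - q \<theta>)" for \<theta>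
      using uv u by (simp add: pmf_M pmf_E_0)
    show "measure_pmf.prob (mass M \<theta>) {x, u} = 1 - p" for \<theta>
      using uv by (simp add: measure_measure_pmf_finite pmf_x pmf_u algebra_simps)
    show "bij_betw (\<lambda>y. if y = a then x else u) (outcomes (two_point_model a b q)) {x, u}"
      using ab uv by (auto simp: bij_betw_def inj_on_def two_point_model_def)
    show "pmf (mass (two_point_model a b q) \<theta>) y =
        pmf (mass M \<theta>) (if y = a then x else u) / (1 - p)"
      if "y \<in> outcomes (two_point_model a b q)" for \<theta> y
      using that ab p q[of \<theta>]
      by (auto simp: two_point_model_def pmf_two_point_pmf pmf_x pmf_u less_imp_le)
  qed (use baseM p in auto)
  ultimately show ?thesis
    by (rule that)
qed

lemma likelihood_rel_chain:
  fixes I I' :: "('u::infinite, 'p) inference_base"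
  assumes "(I, I') \<in> likelihood_rel"
  shows "\<exists>J1\<in>inference_bases. \<exists>J2\<in>inference_bases. \<exists>J3\<in>inference_bases.
    (I, J1) \<in> conditionality_rel \<and> (J1, J2) \<in> conditionality_rel \<and>
    (J2, J3) \<in> conditionality_rel \<and> (J3, I') \<in> conditionality_rel"
proof -
  obtain E1 x1 E2 x2 k where I: "I = (E1, x1)" "I' = (E2, x2)"
    and base: "(E1, x1) \<in> inference_bases" "(E2, x2) \<in> inference_bases"
    and k: "k > 0" "\<And>\<theta>. pmf (mass E1 \<theta>) x1 = k * pmf (mass E2 \<theta>) x2"
    using assms by (auto simp: likelihood_rel_def)
  obtain a b :: 'u where ab: "a \<noteq> b"
    using ex_new_if_finite[OF infinite_UNIV, of "{undefined :: 'u}"] by blast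
  \<comment> \<open>This choice puts both scaling factors, \<open>s\<close> and \<open>s * k = k / (1 + k)\<close>, in the open unit interval.\<close>
  define s where "s = 1 / (1 + k)"
  have s: "0 < s" "s < 1" "0 < s * k" "s * k < 1"
    using k(1) by (auto simp: s_def field_simps)
  define J2 where "J2 = (two_point_model a b (\<lambda>\<theta>. s * pmf (mass E1 \<theta>) x1), a)"
  obtain J1 where J1: "(J1, (E1, x1)) \<in> conditional_step" "(J1, J2) \<in> conditional_step"
    using conditional_bridge[OF base(1) s(1,2) ab] unfolding J2_def by blast
  have "J2 = (two_point_model a b (\<lambda>\<theta>. (s * k) * pmf (mass E2 \<theta>) x2), a)"
    by (simp add: J2_def k(2) mult.assoc)
  then obtain J3 where J3: "(J3, (E2, x2)) \<in> conditional_step" "(J3, J2) \<in> conditional_step"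
    using conditional_bridge[OF base(2) s(3,4) ab] by metis
  have "J1 \<in> inference_bases" "J2 \<in> inference_bases" "J3 \<in> inference_bases"
    using J1 J3 by (auto simp: conditional_step_def)
  then show ?thesis
    using J1 J3 unfolding I conditionality_rel_def by blast
qed

lemma equiv_closure_subset:
  assumes "equiv I R" "D \<subseteq> R"
  shows "equiv_closure I D \<subseteq> R"
  using assms by (auto simp: equiv_closure_def)

lemma likelihood_rel_subset_equiv_closure:
  fixes D :: "('u::infinite, 'p) inference_base rel"
  assumes "conditionality_rel \<subseteq> D"
  shows "likelihood_rel \<subseteq> equiv_closure inference_bases D"
proof (rule subrelI)
  fix I I' :: "('u, 'p) inference_base"
  assume "(I, I') \<in> likelihood_rel"
  then obtain J1 J2 J3 where chain: "(I, J1) \<in> D" "(J1, J2) \<in> D" "(J2, J3) \<in> D" "(J3, I') \<in> D"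
    using likelihood_rel_chain assms by blast
  have "(I, I') \<in> R" if R: "equiv inference_bases R" "D \<subseteq> R" for R
  proof -
    have "trans R"
      using R(1) by (simp add: equiv_def)
    then show ?thesis
      using chain R(2) by (meson subsetD transD)
  qed
  then show "(I, I') \<in> equiv_closure inference_bases D"
    by (simp add: equiv_closure_def)
qed

theorem mainTheorem2:
  fixes L S C :: "('u::infinite, 'p::finite) inference_base rel"
  defines "L \<equiv> likelihood_rel"
    and "S \<equiv> sufficiency_rel"
    and "C \<equiv> conditionality_rel"
  shows "equiv_closure inference_bases C = L \<and>
         equiv_closure inference_bases (C \<union> S) = L \<and>
         (\<forall>I I'. (I, I') \<in> L \<longrightarrow>
            (\<exists>J1\<in>inference_bases. \<exists>J2\<in>inference_bases. \<exists>J3\<in>inference_bases.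
               (I, J1) \<in> C \<and> (J1, J2) \<in> C \<and> (J2, J3) \<in> C \<and> (J3, I') \<in> C))"
proof (intro conjI allI impI)
  show "equiv_closure inference_bases C = L"
    unfolding C_def L_def
    by (intro equalityI equiv_closure_subset equiv_likelihood_rel conditionality_rel_subset
        likelihood_rel_subset_equiv_closure subset_refl)
  show "equiv_closure inference_bases (C \<union> S) = L"
    unfolding C_def L_def S_def
    by (intro equalityI equiv_closure_subset equiv_likelihood_rel conditionality_rel_subset
        sufficiency_rel_subset likelihood_rel_subset_equiv_closure Un_least Un_upper1)
qed (unfold L_def C_def, rule likelihood_rel_chain)

end
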